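(* Let $K\ge 1$ be an integer, $\mathcal{K}=\{1,\dots,K\}$, $\rho=1/K$, and let $P_0>0$, $P_r>0$, $\sigma^2>0$. Let $h_k,g_k\in\mathbb{C}\setminus\{0\}$ for $k\in\mathcal{K}$ and $f\in\mathbb{C}$. Let $\bar e$ be the optimal value of the single-relay mean-square-error minimization problem $$\min_{\{a_{k,1}\},\{a_{k,2}\},b,c_1,c_2}\ \sum_{k=1}^K\left|c_1h_ka_{k,1}+c_2fbg_ka_{k,1}+c_2h_ka_{k,2}-\rho\right|^2+\left(|c_1|^2+|c_2|^2+|c_2|^2|f|^2|b|^2\right)\sigma^2$$ over complex numbers $a_{k,1},a_{k,2}$ ($k\in\mathcal{K}$), $b,c_1,c_2$, subject to $$|a_{k,1}|^2\le P_0,\quad |a_{k,2}|^2\le P_0\quad (\forall k\in\mathcal{K}),\qquad |b|^2\left(\sum_{k=1}^K|g_k|^2|a_{k,1}|^2+\sigma^2\right)\le P_r .$$ Let $$\bar e_{\text{no-relay}}=\frac{\rho^2\sigma^2}{2P_0}\max_{k\in\mathcal{K}}\frac{1}{|h_k|^2},$$ and set $\mathrm{SNR}_k=P_0|h_k|^2/\sigma^2$, $\mathrm{SNR}_{k,\text{relay}}=P_0|g_k|^2/\sigma^2$, $\mathrm{SNR}_{\text{relay-AP}}=P_r|f|^2/\sigma^2$, and $$\delta=\frac{\min_{k\in\mathcal{K}}\mathrm{SNR}_k}{\min_{k\in\mathcal{K}}\mathrm{SNR}_{k,\text{relay}}}.$$ If $$\delta\le 1\qquad\text{and}\qquad \mathrm{SNR}_{\text{relay-AP}}\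 \ge\ \frac{K\min_{k\in\mathcal{K}}\mathrm{SNR}_k+\delta}{\left(1+\sqrt{2-2\delta}\right)^2},$$ then $$\bar e\le \bar e_{\text{no-relay}}.$$
   Context: Interpretation: $K$ devices send signals to an access point (AP), assisted by one amplify-and-forward relay. $h_k$, $g_k$, $f$ are the device-to-AP, device-to-relay and relay-to-AP channel coefficients; $P_0$ is the device power budget per phase, $P_r$ the relay power budget, $\sigma^2$ the noise variance; $\rho$ is the common aggregation weight. $\bar e$ is the minimum model aggregation error with the relay, and $\bar e_{\text{no-relay}}$ is the model aggregation error of the scheme without relays, taken to be given by the displayed formula. The optimal value of the problem is the infimum of the objective over the feasible set. *)

theory Defs
  imports Complex_Main
begin

text \<open>
  Devices are indexed by \<open>{1..K}\<close>. Device-indexed families (\<open>h\<close>, \<open>g\<close>, \<open>a1\<close>, \<open>a2\<close>) are functions on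
  \<open>nat\<close> of which only the values on \<open>{1..K}\<close> matter; \<open>a1\<close>, \<open>a2\<close> are the device transmit
  coefficients in phases 1 and 2, \<open>b\<close> is the relay coefficient, and \<open>c1\<close>, \<open>c2\<close> are the receive
  coefficients of the access point.
\<close>

definition relay_mse ::
  "nat \<Rightarrow> real \<Rightarrow> real \<Rightarrow> (nat \<Rightarrow> complex) \<Rightarrow> (nat \<Rightarrow> complex) \<Rightarrow> complex \<Rightarrow>
   (nat \<Rightarrow> complex) \<Rightarrow> (nat \<Rightarrow> complex) \<Rightarrow> complex \<Rightarrow> complex \<Rightarrow> complex \<Rightarrow> real" where
  "relay_mse K \<rho> \<sigma> h g f a1 a2 b c1 c2 =
     (\<Sum>k\<in>{1..K}. (cmod (c1 * h k * a1 k + c2 * f * b * g k * a1 k + c2 * h k * a2 k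
                          - complex_of_real \<rho>))\<^sup>2)
     + ((cmod c1)\<^sup>2 + (cmod c2)\<^sup>2 + (cmod c2)\<^sup>2 * (cmod f)\<^sup>2 * (cmod b)\<^sup>2) * \<sigma>\<^sup>2"

definition relay_feasible ::
  "nat \<Rightarrow> real \<Rightarrow> real \<Rightarrow> real \<Rightarrow> (nat \<Rightarrow> complex) \<Rightarrow>
   (nat \<Rightarrow> complex) \<Rightarrow> (nat \<Rightarrow> complex) \<Rightarrow> complex \<Rightarrow> bool" where
  "relay_feasible K P0 Pr \<sigma> g a1 a2 b \<longleftrightarrow>
     (\<forall>k\<in>{1..K}. (cmod (a1 k))\<^sup>2 \<le> P0) \<and>
     (\<forall>k\<in>{1..K}. (cmod (a2 k))\<^sup>2 \<le> P0) \<and>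
     (cmod b)\<^sup>2 * ((\<Sum>k\<in>{1..K}. (cmod (g k))\<^sup>2 * (cmod (a1 k))\<^sup>2) + \<sigma>\<^sup>2) \<le> Pr"

definition relay_mse_values ::
  "nat \<Rightarrow> real \<Rightarrow> real \<Rightarrow> real \<Rightarrow> real \<Rightarrow> (nat \<Rightarrow> complex) \<Rightarrow> (nat \<Rightarrow> complex) \<Rightarrow> complex \<Rightarrow> real set"
  where
  "relay_mse_values K \<rho> P0 Pr \<sigma> h g f =
     {relay_mse K \<rho> \<sigma> h g f a1 a2 b c1 c2 | a1 a2 b c1 c2.
        relay_feasible K P0 Pr \<sigma> g a1 a2 b}"

definition relay_min_error ::
  "nat \<Rightarrow> real \<Rightarrow> real \<Rightarrow> real \<Rightarrow> real \<Rightarrow> (nat \<Rightarrow> complex) \<Rightarrow> (nat \<Rightarrow> complex) \<Rightarrow> complex \<Rightarrow> real" where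
  "relay_min_error K \<rho> P0 Pr \<sigma> h g f = Inf (relay_mse_values K \<rho> P0 Pr \<sigma> h g f)"

text \<open>
  The set of objective values is nonempty and bounded below, so the infimum in \<^const>\<open>relay_min_error\<close>
  is a genuine one.
\<close>

lemma relay_mse_values_nonempty:
  assumes "P0 \<ge> 0" "Pr \<ge> 0"
  shows "relay_mse_values K \<rho> P0 Pr \<sigma> h g f \<noteq> {}"
proof -
  have "relay_feasible K P0 Pr \<sigma> g (\<lambda>_. 0) (\<lambda>_. 0) 0"
    using assms by (simp add: relay_feasible_def)
  then show ?thesis unfolding relay_mse_values_def by blast
qed

lemma relay_mse_nonneg: "relay_mse K \<rho> \<sigma> h g f a1 a2 b c1 c2 \<ge> 0"
  unfolding relay_mse_def
  by (intro add_nonneg_nonneg sum_nonneg mult_nonneg_nonneg zero_le_power2)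

lemma relay_mse_values_bdd_below: "bdd_below (relay_mse_values K \<rho> P0 Pr \<sigma> h g f)"
  unfolding relay_mse_values_def
  by (rule bdd_belowI[of _ 0]) (auto simp: relay_mse_nonneg)

definition no_relay_error :: "nat \<Rightarrow> real \<Rightarrow> real \<Rightarrow> real \<Rightarrow> (nat \<Rightarrow> complex) \<Rightarrow> real" where
  "no_relay_error K \<rho> P0 \<sigma> h =
     \<rho>\<^sup>2 * \<sigma>\<^sup>2 / (2 * P0) * (MAX k\<in>{1..K}. 1 / (cmod (h k))\<^sup>2)"

text \<open>
  Used for all three kinds of links: device to access point and device to relay (with power \<open>P0\<close>),
  and relay to access point (with power \<open>Pr\<close>).
\<close>

definition snr :: "real \<Rightarrow> complex \<Rightarrow> real \<Rightarrow> real" where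
  "snr P h \<sigma> = P * (cmod h)\<^sup>2 / \<sigma>\<^sup>2"

definition min_snr :: "nat \<Rightarrow> real \<Rightarrow> (nat \<Rightarrow> complex) \<Rightarrow> real \<Rightarrow> real" where
  "min_snr K P h \<sigma> = (MIN k\<in>{1..K}. snr P (h k) \<sigma>)"

definition snr_ratio ::
  "nat \<Rightarrow> real \<Rightarrow> (nat \<Rightarrow> complex) \<Rightarrow> (nat \<Rightarrow> complex) \<Rightarrow> real \<Rightarrow> real" where
  "snr_ratio K P0 h g \<sigma> = min_snr K P0 h \<sigma> / min_snr K P0 g \<sigma>"

end

(*
  Switch the direct link off in the first phase (c1 = 0) and invert the remaining channels: every
  device aligns its signal at the relay with the weakest device-to-relay channel and, in the
  second phase, at the access point with the weakest direct channel. The misalignment vanishes and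
  only noise remains. With s = sqrt (2 - 2 \<delta>), the relay gain |f b| = sqrt \<delta> / (1 + s) makes this
  noise exactly the error without relay, and its power constraint is the hypothesis on the
  relay-to-AP SNR.
*)
theory Submission
  imports Defs
begin

text \<open>With \<open>P\<close> and \<sigma> common to all links, ordering by SNR is ordering by
  channel gain, so a device of least SNR supplies the uniform lower bound on gains that channel
  inversion requires.\<close>

lemma min_snr_attained:
  assumes "K \<ge> 1" "P > 0" "\<sigma>\<^sup>2 > 0"
  obtains i where "i \<in> {1..K}" "\<forall>k\<in>{1..K}. cmod (h i) \<le> cmod (h k)"
    "min_snr K P h \<sigma> = snr P (h i) \<sigma>"
proof -
  have "(MIN k\<in>{1..K}. snr P (h k) \<sigma>) \<in> (\<lambda>k. snr P (h k) \<sigma>) ` {1..K}"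
    using assms(1) by (intro Min_in) auto
  then obtain i where i: "i \<in> {1..K}" "min_snr K P h \<sigma> = snr P (h i) \<sigma>"
    by (auto simp: min_snr_def)
  have "cmod (h i) \<le> cmod (h k)" if "k \<in> {1..K}" for k
  proof -
    have "snr P (h i) \<sigma> \<le> snr P (h k) \<sigma>"
      unfolding i(2)[symmetric] min_snr_def using that by (intro Min_le) auto
    then have "(cmod (h i))\<^sup>2 \<le> (cmod (h k))\<^sup>2"
      using assms(2,3) by (simp add: snr_def divide_le_cancel)
    then show ?thesis
      by (rule power2_le_imp_le) simp
  qed
  then show ?thesis
    using i that by blast
qed

text \<open>The amplitude \<open>sqrt P * m\<close> is what a channel of gain \<open>m\<close>
  delivers at full power; a stronger channel \<open>z\<close> delivers it with less.\<close>

lemma cmod_channel_inversion_le: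
  assumes "0 < m" "m \<le> cmod z" "P > 0"
  shows "(cmod (complex_of_real (sqrt P * m) / z))\<^sup>2 \<le> P"
proof -
  have "m\<^sup>2 \<le> (cmod z)\<^sup>2"
    using assms by (intro power_mono) auto
  then have "P * m\<^sup>2 \<le> P * (cmod z)\<^sup>2" "(cmod z)\<^sup>2 > 0"
    using assms by (auto intro: mult_left_mono)
  then show ?thesis
    using assms by (simp add: norm_divide norm_mult power_divide power_mult_distrib divide_le_eq)
qed

text \<open>Here \<open>x\<close> is the gain |f b| of the relay path. Aligned devices reach the
  relay with power \<open>P0 * G\<^sup>2\<close> each, so \<open>pow\<close> is the relay power
  constraint multiplied by \<open>(cmod f)\<^sup>2\<close>. The bound is the noise left at this
  feasible point.\<close>

lemma relay_min_error_le_channel_inversion: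
  fixes H G x :: real
  assumes "P0 > 0" "x > 0" "f \<noteq> 0" "H > 0" "G > 0"
    and H: "\<forall>k\<in>{1..K}. H \<le> cmod (h k)"
    and G: "\<forall>k\<in>{1..K}. G \<le> cmod (g k)"
    and pow: "x\<^sup>2 * (real K * (P0 * G\<^sup>2) + \<sigma>\<^sup>2) \<le> Pr * (cmod f)\<^sup>2"
  shows "relay_min_error K \<rho> P0 Pr \<sigma> h g f
      \<le> \<rho>\<^sup>2 * \<sigma>\<^sup>2 * (1 + x\<^sup>2) / (P0 * (x * G + H)\<^sup>2)"
proof -
  define a1 where "a1 k = complex_of_real (sqrt P0 * G) / g k" for k
  define a2 where "a2 k = complex_of_real (sqrt P0 * H) / h k" for k
  define b where "b = complex_of_real x / f"
  \<comment> \<open>Over both phases every device arrives with the same total amplitude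
    \<open>sqrt P0 * (x * G + H)\<close>; the receive coefficient \<open>r\<close>, used as
    \<open>c2\<close>, rescales it to \<rho>.\<close>
  define r where "r = \<rho> / (sqrt P0 * (x * G + H))"
  have nz: "h k \<noteq> 0" "g k \<noteq> 0" if "k \<in> {1..K}" for k
    using H G that \<open>H > 0\<close> \<open>G > 0\<close> by fastforce+
  have pos: "x * G + H > 0"
    using assms by (simp add: add_pos_pos)
  have bf: "(cmod b)\<^sup>2 = x\<^sup>2 / (cmod f)\<^sup>2"
    by (simp add: b_def norm_divide power_divide)
  have "(\<Sum>k\<in>{1..K}. (cmod (g k))\<^sup>2 * (cmod (a1 k))\<^sup>2) = (\<Sum>k\<in>{1..K}. P0 * G\<^sup>2)"
    using nz \<open>P0 > 0\<close>
    by (intro sum.cong) (auto simp: a1_def norm_divide norm_mult power_divide power_mult_distrib)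
  then have "(cmod b)\<^sup>2 * ((\<Sum>k\<in>{1..K}. (cmod (g k))\<^sup>2 * (cmod (a1 k))\<^sup>2) + \<sigma>\<^sup>2) \<le> Pr"
    using pow \<open>f \<noteq> 0\<close> by (simp add: bf divide_le_eq)
  moreover have "(cmod (a1 k))\<^sup>2 \<le> P0" "(cmod (a2 k))\<^sup>2 \<le> P0" if "k \<in> {1..K}" for k
    unfolding a1_def a2_def using that assms by (blast intro: cmod_channel_inversion_le)+
  ultimately have "relay_feasible K P0 Pr \<sigma> g a1 a2 b"
    by (simp add: relay_feasible_def)
  then have "relay_min_error K \<rho> P0 Pr \<sigma> h g f \<le> relay_mse K \<rho> \<sigma> h g f a1 a2 b 0 r"
    unfolding relay_min_error_def
    by (intro cInf_lower relay_mse_values_bdd_below) (unfold relay_mse_values_def, blast)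
  also have "relay_mse K \<rho> \<sigma> h g f a1 a2 b 0 r = r\<^sup>2 * (1 + x\<^sup>2) * \<sigma>\<^sup>2"
  proof -
    have "0 * h k * a1 k + r * f * b * g k * a1 k + r * h k * a2 k = \<rho>" if "k \<in> {1..K}" for k
    proof -
      have "0 * h k * a1 k + r * f * b * g k * a1 k + r * h k * a2 k
          = complex_of_real (r * (sqrt P0 * (x * G + H)))"
        using nz[OF that] \<open>f \<noteq> 0\<close> by (simp add: a1_def a2_def b_def algebra_simps)
      also have "r * (sqrt P0 * (x * G + H)) = \<rho>"
        using pos \<open>P0 > 0\<close> by (simp add: r_def)
      finally show ?thesis .
    qed
    then have "(\<Sum>k\<in>{1..K}. (cmod (0 * h k * a1 k + r * f * b * g k * a1 k + r * h k * a2 k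
                          - complex_of_real \<rho>))\<^sup>2) = 0"
      by (intro sum.neutral) auto
    then show ?thesis
      unfolding relay_mse_def using \<open>f \<noteq> 0\<close> by (simp add: bf algebra_simps)
  qed
  also have "\<dots> = \<rho>\<^sup>2 * \<sigma>\<^sup>2 * (1 + x\<^sup>2) / (P0 * (x * G + H)\<^sup>2)"
    using \<open>P0 > 0\<close> by (simp add: r_def power_divide power_mult_distrib)
  finally show ?thesis .
qed

text \<open>With t = x G / H the claim reads 2 (1 + \<delta> t^2) = (1 + t)^2, a quadratic in t
  whose discriminant is nonnegative exactly when \<delta> \<le> 1. The choice t = 1 / (1 + sqrt (2 -
  2 \<delta>)) is its smallest positive root, hence the least demanding on relay power.\<close>

lemma relay_gain_balance:
  fixes H G \<delta> :: real
  assumes "H > 0" "G > 0" "\<delta> = H\<^sup>2 / G\<^sup>2" "\<delta> \<le> 1"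
  defines "x \<equiv> H / (G * (1 + sqrt (2 - 2 * \<delta>)))"
  shows "(1 + x\<^sup>2) / (x * G + H)\<^sup>2 = 1 / (2 * H\<^sup>2)"
proof -
  define s where "s = sqrt (2 - 2 * \<delta>)"
  have s: "s \<ge> 0" "s\<^sup>2 = 2 - 2 * \<delta>"
    using \<open>\<delta> \<le> 1\<close> by (simp_all add: s_def)
  then have nz: "1 + s \<noteq> 0" "2 + s \<noteq> 0"
    by auto
  have "x\<^sup>2 = \<delta> / (1 + s)\<^sup>2"
    using assms by (simp add: x_def s_def power_divide power_mult_distrib)
  moreover have "x * G + H = H * (2 + s) / (1 + s)"
  proof -
    have "x * G = H / (1 + s)"
      using \<open>G > 0\<close> by (simp add: x_def s_def)
    then show ?thesis
      using nz by (simp add: add_divide_eq_iff divide_add_eq_iff algebra_simps)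
  qed
  ultimately have "(1 + x\<^sup>2) / (x * G + H)\<^sup>2
      = ((1 + s)\<^sup>2 + \<delta>) / (1 + s)\<^sup>2 / (H\<^sup>2 * (2 + s)\<^sup>2 / (1 + s)\<^sup>2)"
    using nz by (simp add: power_divide power_mult_distrib add_divide_distrib)
  also have "\<dots> = ((1 + s)\<^sup>2 + \<delta>) / (H\<^sup>2 * (2 + s)\<^sup>2)"
    using nz by simp
  \<comment> \<open>Substituting \<delta> = 1 - s^2 / 2 completes the square.\<close>
  also have "(1 + s)\<^sup>2 + \<delta> = (2 + s)\<^sup>2 / 2"
    using s by (simp add: power2_eq_square algebra_simps)
  also have "(2 + s)\<^sup>2 / 2 / (H\<^sup>2 * (2 + s)\<^sup>2) = 1 / (2 * H\<^sup>2)"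
    using nz by simp
  finally show ?thesis .
qed

theorem theorem4p1:
  fixes K :: nat and \<rho> P0 Pr \<sigma> \<delta> :: real
    and h g :: "nat \<Rightarrow> complex" and f :: complex
  assumes "K \<ge> 1"
    and "\<rho> = 1 / real K"
    and "P0 > 0" and "Pr > 0" and "\<sigma>\<^sup>2 > 0"
    and "\<forall>k\<in>{1..K}. h k \<noteq> 0"
    and "\<forall>k\<in>{1..K}. g k \<noteq> 0"
    and "\<delta> = snr_ratio K P0 h g \<sigma>"
    and "\<delta> \<le> 1"
    and "snr Pr f \<sigma> \<ge> (real K * min_snr K P0 h \<sigma> + \<delta>) / (1 + sqrt (2 - 2 * \<delta>))\<^sup>2"
  shows "relay_min_error K \<rho> P0 Pr \<sigma> h g f \<le> no_relay_error K \<rho> P0 \<sigma> h"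
proof -
  obtain i where i: "i \<in> {1..K}" "\<forall>k\<in>{1..K}. cmod (h i) \<le> cmod (h k)"
    "min_snr K P0 h \<sigma> = snr P0 (h i) \<sigma>"
    using min_snr_attained[OF \<open>K \<ge> 1\<close> \<open>P0 > 0\<close> \<open>\<sigma>\<^sup>2 > 0\<close>] by blast
  obtain j where j: "j \<in> {1..K}" "\<forall>k\<in>{1..K}. cmod (g j) \<le> cmod (g k)"
    "min_snr K P0 g \<sigma> = snr P0 (g j) \<sigma>"
    using min_snr_attained[OF \<open>K \<ge> 1\<close> \<open>P0 > 0\<close> \<open>\<sigma>\<^sup>2 > 0\<close>] by blast
  define H where "H = cmod (h i)"
  define G where "G = cmod (g j)"
  define s where "s = sqrt (2 - 2 * \<delta>)"
  define x where "x = H / (G * (1 + s))"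
  have pos: "H > 0" "G > 0"
    using i j assms by (auto simp: H_def G_def)
  have \<delta>: "\<delta> = H\<^sup>2 / G\<^sup>2"
    using assms by (simp add: snr_ratio_def i j snr_def H_def G_def)
  have "s \<ge> 0"
    using assms by (simp add: s_def)
  then have s: "1 + s > 0"
    by simp
  have "x > 0"
    using pos s by (simp add: x_def)
  have "x\<^sup>2 = \<delta> / (1 + s)\<^sup>2" "\<delta> * G\<^sup>2 = H\<^sup>2"
    using pos by (simp_all add: x_def \<delta> power_divide power_mult_distrib)
  \<comment> \<open>The factor \<delta> in \<open>x\<^sup>2\<close> trades the relay-side gain
    \<open>G\<close> for the direct gain \<open>H\<close>, which produces the numerator of the SNR
    hypothesis.\<close>
  then have "x\<^sup>2 * (real K * (P0 * G\<^sup>2) + \<sigma>\<^sup>2) = (real K * (P0 * H\<^sup>2) + \<delta> * \<sigma>\<^sup>2) / (1 + s)\<^sup>2"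
    by (simp add: algebra_simps add_divide_distrib flip: \<open>\<delta> * G\<^sup>2 = H\<^sup>2\<close>)
  also have "\<dots> = (real K * min_snr K P0 h \<sigma> + \<delta>) / (1 + s)\<^sup>2 * \<sigma>\<^sup>2"
    using assms(5) by (simp add: i snr_def H_def distrib_right)
  also have "\<dots> \<le> snr Pr f \<sigma> * \<sigma>\<^sup>2"
    unfolding s_def using assms by (intro mult_right_mono) auto
  also have "\<dots> = Pr * (cmod f)\<^sup>2"
    using assms by (simp add: snr_def)
  finally have pow: "x\<^sup>2 * (real K * (P0 * G\<^sup>2) + \<sigma>\<^sup>2) \<le> Pr * (cmod f)\<^sup>2" .
  \<comment> \<open>A vanishing \<open>f\<close> would make the right side of \<open>pow\<close>
    zero; the SNR hypothesis thus excludes it, and the relay coefficient x / f is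
    meaningful.\<close>
  have "0 < x\<^sup>2 * (real K * (P0 * G\<^sup>2) + \<sigma>\<^sup>2)"
    using \<open>x > 0\<close> assms by (intro mult_pos_pos add_nonneg_pos) auto
  with pow have "f \<noteq> 0"
    by auto
  have "relay_min_error K \<rho> P0 Pr \<sigma> h g f
      \<le> \<rho>\<^sup>2 * \<sigma>\<^sup>2 * (1 + x\<^sup>2) / (P0 * (x * G + H)\<^sup>2)"
    using i j pos pow \<open>x > 0\<close> \<open>f \<noteq> 0\<close> assms
    by (intro relay_min_error_le_channel_inversion) (auto simp: H_def G_def)
  also have "\<dots> = \<rho>\<^sup>2 * \<sigma>\<^sup>2 / P0 * ((1 + x\<^sup>2) / (x * G + H)\<^sup>2)"
    by simp
  also have "\<dots> = \<rho>\<^sup>2 * \<sigma>\<^sup>2 / (2 * P0) * (1 / H\<^sup>2)"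
    using relay_gain_balance[OF pos \<delta> \<open>\<delta> \<le> 1\<close>] by (simp add: x_def s_def)
  \<comment> \<open>\<open>1 / H\<^sup>2\<close> is the term of index \<open>i\<close> in the
    maximum.\<close>
  also have "\<dots> \<le> no_relay_error K \<rho> P0 \<sigma> h"
    unfolding no_relay_error_def H_def using i(1) \<open>P0 > 0\<close>
    by (intro mult_left_mono Max_ge) auto
  finally show ?thesis .
qed

end
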